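(* For every integer $\ell \geq 3$ and every positive integer $n$ divisible by $2^{\ell-1}$, we have $\frac{(\ell-1)!}{2}\,n \leq \mathrm{ex}^*(n, C_\ell, P_\ell)$.
   Context: An edge-coloring of a graph is proper if any two edges sharing a vertex receive different colors. An edge-colored graph is rainbow if no two of its edges receive the same color; a rainbow-$F$ is a rainbow subgraph isomorphic to $F$. $P_\ell$ denotes the path with $\ell$ edges ($\ell+1$ vertices) and $C_\ell$ the cycle of length $\ell$. For graphs $H$ and $F$, $\mathrm{ex}^*(n,H,F)$ is the maximum number of rainbow copies of $H$ (as subgraphs) in an $n$-vertex simple graph with a proper edge-coloring that contains no rainbow copy of $F$. *)

theory Defs
  imports Complex_Main
begin

record 'a ugraph =
  verts :: "'a set"
  edges :: "'a set set"

definition simple_graph :: "'a ugraph \<Rightarrow> bool" where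
  "simple_graph G \<longleftrightarrow>
     finite (verts G) \<and> (\<forall>e\<in>edges G. e \<subseteq> verts G \<and> card e = 2)"

definition subgraph :: "'a ugraph \<Rightarrow> 'a ugraph \<Rightarrow> bool" where
  "subgraph K G \<longleftrightarrow> simple_graph K \<and> verts K \<subseteq> verts G \<and> edges K \<subseteq> edges G"

definition isomorphic :: "'a ugraph \<Rightarrow> 'b ugraph \<Rightarrow> bool" where
  "isomorphic G H \<longleftrightarrow>
     (\<exists>f. bij_betw f (verts G) (verts H) \<and> (\<lambda>e. f ` e) ` edges G = edges H)"

definition path_graph :: "nat \<Rightarrow> nat ugraph" where
  "path_graph l = \<lparr>verts = {0..l}, edges = {{i, Suc i} |i. i < l}\<rparr>"

text \<open>The following is a simple graph, and the intended cycle, only for \<open>l \<ge> 3\<close>.\<close>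

definition cycle_graph :: "nat \<Rightarrow> nat ugraph" where
  "cycle_graph l = \<lparr>verts = {0..<l}, edges = {{i, Suc i mod l} |i. i < l}\<rparr>"

definition proper_edge_coloring :: "'a ugraph \<Rightarrow> ('a set \<Rightarrow> 'c) \<Rightarrow> bool" where
  "proper_edge_coloring G c \<longleftrightarrow>
     (\<forall>e\<in>edges G. \<forall>f\<in>edges G. e \<noteq> f \<and> e \<inter> f \<noteq> {} \<longrightarrow> c e \<noteq> c f)"

definition rainbow :: "'a ugraph \<Rightarrow> ('a set \<Rightarrow> 'c) \<Rightarrow> bool" where
  "rainbow G c \<longleftrightarrow> inj_on c (edges G)"

definition rainbow_copies :: "'a ugraph \<Rightarrow> ('a set \<Rightarrow> 'c) \<Rightarrow> 'b ugraph \<Rightarrow> 'a ugraph set" where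
  "rainbow_copies G c H = {K. subgraph K G \<and> isomorphic K H \<and> rainbow K c}"

text \<open>Taking vertices and colors in \<^typ>\<open>nat\<close> is no restriction, as graphs are finite.
  The number of colors is not bounded.\<close>

definition rainbow_counts :: "nat \<Rightarrow> 'a ugraph \<Rightarrow> 'b ugraph \<Rightarrow> nat set" where
  "rainbow_counts n H F =
     {card (rainbow_copies G c H) |(G :: nat ugraph) (c :: nat set \<Rightarrow> nat).
        simple_graph G \<and> card (verts G) = n \<and> proper_edge_coloring G c \<and>
        rainbow_copies G c F = {}}"

definition ex_star :: "nat \<Rightarrow> 'a ugraph \<Rightarrow> 'b ugraph \<Rightarrow> nat" where
  "ex_star n H F = Max (rainbow_counts n H F)"

text \<open>\<^const>\<open>Max\<close> is unspecified on infinite or empty sets; neither case arises for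
  \<open>F\<close> with at least one edge.\<close>

lemma finite_rainbow_counts: "finite (rainbow_counts n H F)"
proof -
  have "card (rainbow_copies G c H) \<le> 2 ^ n * 2 ^ 2 ^ n"
    if G: "simple_graph G" "card (verts G) = n" for G :: "nat ugraph" and c :: "nat set \<Rightarrow> nat"
  proof -
    let ?S = "Pow (verts G) \<times> Pow (Pow (verts G))"
    let ?g = "\<lambda>K. (verts K, edges K)"
    have fin: "finite (verts G)"
      using G by (simp add: simple_graph_def)
    have "?g ` rainbow_copies G c H \<subseteq> ?S"
      using G by (auto simp: rainbow_copies_def subgraph_def simple_graph_def)
    moreover have "inj_on ?g (rainbow_copies G c H)"
      by (auto intro!: inj_onI ugraph.equality)
    ultimately have "card (rainbow_copies G c H) \<le> card ?S"
      using fin by (intro card_inj_on_le[of ?g]) auto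
    also have "\<dots> = 2 ^ n * 2 ^ 2 ^ n"
      using fin G by (simp add: card_cartesian_product card_Pow)
    finally show ?thesis .
  qed
  then have "rainbow_counts n H F \<subseteq> {..2 ^ n * 2 ^ 2 ^ n}"
    unfolding rainbow_counts_def by blast
  then show ?thesis
    using finite_subset by blast
qed

lemma rainbow_counts_nonempty:
  assumes "edges F \<noteq> {}"
  shows "rainbow_counts n H F \<noteq> {}"
proof -
  let ?G = "\<lparr>verts = {..<n}, edges = {}\<rparr> :: nat ugraph"
  have "simple_graph ?G \<and> card (verts ?G) = n \<and> proper_edge_coloring ?G (\<lambda>_. 0 :: nat) \<and>
      rainbow_copies ?G (\<lambda>_. 0 :: nat) F = {}"
    using assms
    by (auto simp: simple_graph_def proper_edge_coloring_def rainbow_copies_def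
        subgraph_def isomorphic_def)
  then show ?thesis
    unfolding rainbow_counts_def by blast
qed

end

theory Submission
  imports Defs "HOL-Combinatorics.Permutations" "HOL-Library.Nat_Bijection"
begin

text \<open>Put \<open>k = l - 1\<close> and take disjoint copies of the Cayley graph of \<open>\<int>\<^sub>2\<^sup>k\<close> with respect to the
  unit vectors and their sum, each edge being colored by its generator. These \<open>l\<close> generators sum
  to \<open>0\<close>, so a rainbow walk with \<open>l\<close> edges is closed and there is no rainbow \<open>P\<^sub>l\<close>. As no proper
  nonempty subset of them sums to \<open>0\<close>, using the generators in any order from any vertex gives a
  rainbow \<open>C\<^sub>l\<close>. To count each cycle once, start it at the even endpoint of its edge colored by
  the sum generator and traverse that edge last: there are \<open>n / 2\<close> even vertices and \<open>k!\<close> orders of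
  the unit vectors.\<close>

section \<open>Bits and XOR of natural numbers\<close>

unbundle bit_operations_syntax

lemma nat_xor_left_cancel [simp]: "x XOR y = x XOR z \<longleftrightarrow> y = z" for x y z :: nat
proof -
  have "x XOR (x XOR y) = y" "x XOR (x XOR z) = z"
    by (simp_all flip: xor.assoc)
  then show ?thesis
    by metis
qed

lemma bit_set_encode_iff: "finite A \<Longrightarrow> bit (set_encode A) j \<longleftrightarrow> j \<in> A"
  using set_encode_inverse[of A] by (auto simp: set_decode_def bit_iff_odd)

lemma set_encode_lessThan: "set_encode {..<k} = mask k"
  by (rule bit_eqI) (simp add: bit_set_encode_iff bit_mask_iff)

lemma bit_nat_less_power:
  fixes d :: nat
  assumes "d < 2 ^ k" "k \<le> j"
  shows "\<not> bit d j"
proof -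
  have "d < 2 ^ j"
    using assms by (meson less_le_trans one_le_numeral power_increasing)
  then show ?thesis
    by (simp add: bit_iff_odd)
qed

text \<open>XOR with \<open>d < 2 ^ k\<close> leaves \<open>v div 2 ^ k\<close> unchanged, so a step
  along a generator stays in the same copy of the cube.\<close>

lemma xor_less_mult_power:
  fixes v d :: nat
  assumes "v < m * 2 ^ k" "d < 2 ^ k"
  shows "v XOR d < m * 2 ^ k"
proof -
  have "(v XOR d) div 2 ^ k = (v div 2 ^ k) XOR (d div 2 ^ k)"
    using drop_bit_xor[of k v d] by (simp only: drop_bit_eq_div)
  also have "\<dots> < m"
    using assms by (simp add: less_mult_imp_div_less)
  finally show ?thesis
    by (simp add: div_less_iff_less_mult)
qed

section \<open>The generators and walks along them\<close>

text \<open>The unit vectors of \<open>\<int>\<^sub>2\<^sup>k\<close> are the powers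
  \<open>2 ^ j\<close>; their sum is the all-ones vector \<open>mask k\<close>.\<close>

definition generators :: "nat \<Rightarrow> nat set" where
  "generators k = insert (mask k) ((^) 2 ` {..<k})"

text \<open>For \<open>k \<ge> 2\<close> the mask has at least the two bits 0 and 1, a power of two
  only one. For \<open>k = 1\<close> the two generators would coincide.\<close>

lemma mask_neq_power_two: "k \<ge> 2 \<Longrightarrow> mask k \<noteq> (2 ^ j :: nat)"
proof
  assume k: "k \<ge> 2" and eq: "mask k = (2 ^ j :: nat)"
  have "bit (mask k :: nat) 0" "bit (mask k :: nat) 1"
    using k by (auto simp: bit_mask_iff)
  then show False
    unfolding eq by (auto simp: bit_exp_iff)
qed

lemma finite_generators: "finite (generators k)"
  by (simp add: generators_def)

lemma card_generators:
  assumes "k \<ge> 2"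
  shows "card (generators k) = Suc k"
proof -
  have "mask k \<notin> (^) (2 :: nat) ` {..<k}"
    using mask_neq_power_two[OF assms] by auto
  moreover have "card ((^) (2 :: nat) ` {..<k}) = k"
    by (subst card_image) (auto simp: inj_on_def)
  ultimately show ?thesis
    by (simp add: generators_def)
qed

lemma generators_less: "d \<in> generators k \<Longrightarrow> d < 2 ^ k"
  by (auto simp: generators_def mask_eq_exp_minus_1)

lemma zero_notin_generators: "k > 0 \<Longrightarrow> 0 \<notin> generators k"
  by (auto simp: generators_def)

text \<open>Every bit occurs in an even number of generators, so the XOR of all generators is \<open>0\<close>.\<close>

lemma even_card_generators_bit:
  assumes "k \<ge> 2"
  shows "even (card {d \<in> generators k. bit d j})"
proof (cases "j < k")
  case True
  then have "{d \<in> generators k. bit d j} = {mask k, 2 ^ j}"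
    by (auto simp: generators_def bit_mask_iff bit_exp_iff)
  then show ?thesis
    using mask_neq_power_two[OF assms, of j] by simp
next
  case False
  then have "{d \<in> generators k. bit d j} = {}"
    using bit_nat_less_power generators_less by (metis (no_types, lifting) empty_Collect_eq not_less)
  then show ?thesis
    by (simp only: card.empty even_zero)
qed

text \<open>A step toggles bit \<open>j\<close> exactly when its difference has that bit, so only
  the parity of the number of such steps matters.\<close>

lemma bit_walk:
  fixes x :: "nat \<Rightarrow> nat"
  shows "bit (x n) j \<longleftrightarrow> (bit (x 0) j \<noteq> odd (card {i. i < n \<and> bit (x i XOR x (Suc i)) j}))"
proof (induction n)
  case (Suc n)
  let ?P = "\<lambda>i. bit (x i XOR x (Suc i)) j"
  have "{i. i < Suc n \<and> ?P i} = (if ?P n then insert n {i. i < n \<and> ?P i} else {i. i < n \<and> ?P i})"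
    by (auto simp: less_Suc_eq)
  then have "card {i. i < Suc n \<and> ?P i} = (if ?P n then 1 else 0) + card {i. i < n \<and> ?P i}"
    by simp
  then show ?case
    using Suc.IH by (auto simp: bit_xor_iff)
qed simp

text \<open>Each generator is used exactly once, so every bit is toggled an even number of
  times.\<close>

lemma closed_walk_generators:
  fixes x :: "nat \<Rightarrow> nat"
  assumes "k \<ge> 2" and bij: "bij_betw (\<lambda>i. x i XOR x (Suc i)) {..<n} (generators k)"
  shows "x n = x 0"
proof (rule bit_eqI)
  fix j
  let ?d = "\<lambda>i. x i XOR x (Suc i)"
  have "bij_betw ?d {i. i < n \<and> bit (?d i) j} {d \<in> generators k. bit d j}"
    using bij by (auto simp: bij_betw_def inj_on_def)
  then have "card {i. i < n \<and> bit (?d i) j} = card {d \<in> generators k. bit d j}"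
    by (rule bij_betw_same_card)
  then show "bit (x n) j = bit (x 0) j"
    using bit_walk[of x n j] even_card_generators_bit[OF assms(1), of j] by simp
qed

section \<open>The colored Cayley graph and the absence of rainbow paths\<close>

text \<open>\<open>m\<close> disjoint copies of the Cayley graph of \<open>\<int>\<^sub>2\<^sup>k\<close> with respect to the generators: the low
  \<open>k\<close> bits of a vertex are the element of \<open>\<int>\<^sub>2\<^sup>k\<close>, the high bits number the copy.\<close>

definition cayley_graph :: "nat \<Rightarrow> nat \<Rightarrow> nat ugraph" where
  "cayley_graph m k = \<lparr>verts = {..<m * 2 ^ k},
     edges = {{u, v} |u v. u < m * 2 ^ k \<and> v < m * 2 ^ k \<and> u XOR v \<in> generators k}\<rparr>"

text \<open>A color is a function of the edge as a set; \<open>Min\<close> and \<open>Max\<close>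
  name its two endpoints without choosing an order, and XOR is symmetric.\<close>

definition xor_coloring :: "nat set \<Rightarrow> nat" where
  "xor_coloring e = Min e XOR Max e"

lemma xor_coloring_doubleton [simp]: "xor_coloring {u, v} = u XOR v"
  by (simp add: xor_coloring_def min_def max_def xor.commute)

lemma simple_cayley_graph: "k > 0 \<Longrightarrow> simple_graph (cayley_graph m k)"
  using zero_notin_generators[of k]
  by (auto simp: simple_graph_def cayley_graph_def card_2_iff) (metis xor_self_eq)

lemma cayley_edge_iff:
  "{u, v} \<in> edges (cayley_graph m k) \<longleftrightarrow>
     u < m * 2 ^ k \<and> v < m * 2 ^ k \<and> u XOR v \<in> generators k"
  by (auto simp: cayley_graph_def doubleton_eq_iff xor.commute)

lemma cayley_edgeE:
  assumes "e \<in> edges (cayley_graph m k)" "x \<in> e"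
  obtains y where "e = {x, y}"
  using assms by (auto simp: cayley_graph_def)

text \<open>A vertex \<open>x\<close> and a color determine the other endpoint, by cancelling
  \<open>x\<close> in the XOR.\<close>

lemma proper_xor_coloring: "proper_edge_coloring (cayley_graph m k) xor_coloring"
  unfolding proper_edge_coloring_def
proof (intro ballI impI notI)
  fix e f
  assume e: "e \<in> edges (cayley_graph m k)" and f: "f \<in> edges (cayley_graph m k)"
    and ne: "e \<noteq> f \<and> e \<inter> f \<noteq> {}" and eq: "xor_coloring e = xor_coloring f"
  from ne obtain x where "x \<in> e" "x \<in> f"
    by auto
  then obtain y z where "e = {x, y}" "f = {x, z}"
    using e f by (metis cayley_edgeE)
  then show False
    using ne eq by simp
qed

lemma no_rainbow_path:
  assumes "k \<ge> 2"
  shows "rainbow_copies (cayley_graph m k) xor_coloring (path_graph (Suc k)) = {}"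
proof (rule ccontr)
  assume "\<not> ?thesis"
  then obtain K where sub: "subgraph K (cayley_graph m k)" and rb: "rainbow K xor_coloring"
    and iso: "isomorphic K (path_graph (Suc k))"
    by (auto simp: rainbow_copies_def)
  from iso obtain f where f: "bij_betw f (verts K) {0..Suc k}"
    and fe: "(`) f ` edges K = {{i, Suc i} |i. i < Suc k}"
    unfolding isomorphic_def path_graph_def ugraph.simps by (elim exE conjE)
  \<comment> \<open>\<open>x\<close> lists the vertices of the copy in their order along the
    path.\<close>
  define x where "x = inv_into (verts K) f"
  have inj: "inj_on x {0..Suc k}"
    using bij_betw_inv_into[OF f] by (simp add: x_def bij_betw_def)
  have edge: "{x i, x (Suc i)} \<in> edges K" if "i < Suc k" for i
  proof -
    have "{i, Suc i} \<in> (`) f ` edges K"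
      using that unfolding fe by blast
    then obtain e where e: "e \<in> edges K" "f ` e = {i, Suc i}"
      by (elim imageE) simp
    have "e \<subseteq> verts K"
      using sub e by (auto simp: subgraph_def simple_graph_def)
    then have "x ` f ` e = e"
      using f unfolding x_def bij_betw_def by (metis inv_into_image_cancel)
    then show ?thesis
      using e(1) unfolding e(2) by simp
  qed
  have "inj_on (\<lambda>i. x i XOR x (Suc i)) {..<Suc k}"
  proof (rule inj_onI)
    fix i j assume ij: "i \<in> {..<Suc k}" "j \<in> {..<Suc k}" "x i XOR x (Suc i) = x j XOR x (Suc j)"
    then have "{x i, x (Suc i)} = {x j, x (Suc j)}"
      using edge by (intro inj_onD[OF rb[unfolded rainbow_def]]) auto
    then have "x ` {i, Suc i} = x ` {j, Suc j}"
      by simp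
    then have "{i, Suc i} = {j, Suc j}"
      using ij(1,2) by (subst (asm) inj_on_image_eq_iff[OF inj]) auto
    then show "i = j"
      by (auto simp: doubleton_eq_iff)
  qed
  moreover have "(\<lambda>i. x i XOR x (Suc i)) ` {..<Suc k} \<subseteq> generators k"
  proof (rule image_subsetI)
    fix i assume "i \<in> {..<Suc k}"
    then have "{x i, x (Suc i)} \<in> edges (cayley_graph m k)"
      using edge sub unfolding subgraph_def by blast
    then show "x i XOR x (Suc i) \<in> generators k"
      by (simp only: cayley_edge_iff)
  qed
  \<comment> \<open>The \<open>Suc k\<close> edges have distinct colors among \<open>Suc k\<close>
    generators, hence use all of them, and the path would close up.\<close>
  ultimately have "bij_betw (\<lambda>i. x i XOR x (Suc i)) {..<Suc k} (generators k)"
    by (intro bij_betw_imageI card_subset_eq finite_generators)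
      (simp_all only: card_image card_generators[OF assms] card_lessThan)
  then have "x (Suc k) = x 0"
    by (rule closed_walk_generators[OF assms])
  then show False
    using inj_onD[OF inj, of "Suc k" 0] by simp
qed

section \<open>Rainbow cycles from permutations\<close>

text \<open>The position after flipping the coordinates \<open>p 0\<close>, ...,
  \<open>p (i - 1)\<close> of \<open>v\<close>; \<open>set_encode\<close> turns the set of flipped
  coordinates into a bit vector.\<close>

definition cube_walk :: "nat \<Rightarrow> (nat \<Rightarrow> nat) \<Rightarrow> nat \<Rightarrow> nat" where
  "cube_walk v p i = v XOR set_encode (p ` {..<i})"

text \<open>The edge with \<open>i = k\<close> wraps around to \<open>v\<close>: when
  \<open>p\<close> permutes \<open>{..<k}\<close>, it is the one of color
  \<open>mask k\<close>.\<close>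

definition walk_cycle :: "nat \<Rightarrow> nat \<Rightarrow> (nat \<Rightarrow> nat) \<Rightarrow> nat ugraph" where
  "walk_cycle k v p = \<lparr>verts = cube_walk v p ` {0..<Suc k},
     edges = {{cube_walk v p i, cube_walk v p (Suc i mod Suc k)} |i. i < Suc k}\<rparr>"

lemma cube_walk_0 [simp]: "cube_walk v p 0 = v"
  by (simp add: cube_walk_def)

lemma cube_walk_full: "p permutes {..<k} \<Longrightarrow> cube_walk v p k = v XOR mask k"
  by (simp add: cube_walk_def permutes_image set_encode_lessThan)

text \<open>A finite set is recovered from its code, and its size gives the index because
  \<open>p\<close> and \<open>q\<close> are injective.\<close>

lemma set_encode_image_eq_imp:
  fixes p q :: "nat \<Rightarrow> nat"
  assumes "inj p" "inj q" "set_encode (p ` {..<i}) = set_encode (q ` {..<j})"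
  shows "i = j \<and> p ` {..<i} = q ` {..<j}"
proof -
  have "p ` {..<i} = q ` {..<j}"
    using assms(3) by (intro set_encode_eq[THEN iffD1]) simp_all
  moreover have "card (p ` {..<i}) = i" "card (q ` {..<j}) = j"
    using assms(1,2) by (simp_all add: card_image inj_on_subset[OF _ subset_UNIV])
  ultimately show ?thesis
    by metis
qed

lemma inj_cube_walk: "inj p \<Longrightarrow> inj (cube_walk v p)"
  by (rule injI) (auto simp: cube_walk_def dest: set_encode_image_eq_imp)

lemma cube_walk_step:
  assumes "inj p"
  shows "cube_walk v p i XOR cube_walk v p (Suc i) = 2 ^ p i"
  using assms
  by (intro bit_eqI) (auto simp: cube_walk_def bit_simps bit_set_encode_iff lessThan_Suc inj_def)

lemma walk_cycle_color:
  assumes "p permutes {..<k}" "i < Suc k"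
  shows "cube_walk v p i XOR cube_walk v p (Suc i mod Suc k) = (if i < k then 2 ^ p i else mask k)"
proof (cases "i < k")
  case True
  then show ?thesis
    using cube_walk_step[OF permutes_inj[OF assms(1)]] by simp
next
  case False
  with assms(2) have "i = k"
    by simp
  then show ?thesis
    by (simp add: cube_walk_full[OF assms(1)] xor.commute[of _ v] flip: xor.assoc)
qed

text \<open>The walk is injective on all indices, so its inverse maps each vertex of the cycle to
  its position.\<close>

lemma isomorphic_walk_cycle:
  assumes "inj p"
  shows "isomorphic (walk_cycle k v p) (cycle_graph (Suc k))"
proof -
  let ?w = "cube_walk v p"
  have inv: "inv ?w (?w i) = i" for i
    using inj_cube_walk[OF assms] by simp
  have "bij_betw (inv ?w) (?w ` {0..<Suc k}) {0..<Suc k}"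
    by (rule bij_betw_byWitness[where f' = ?w]) (auto simp: inv)
  moreover have "(`) (inv ?w) ` {{?w i, ?w (Suc i mod Suc k)} |i. i < Suc k} =
      {{i, Suc i mod Suc k} |i. i < Suc k}"
    by (auto simp: inv image_iff simp del: mod_Suc) (metis (no_types, lifting) image_empty image_insert inv)
  ultimately show ?thesis
    unfolding isomorphic_def walk_cycle_def cycle_graph_def by (intro exI[of _ "inv ?w"]) simp
qed

lemma walk_cycle_in_rainbow_copies:
  assumes "k \<ge> 2" "v < m * 2 ^ k" and p: "p permutes {..<k}"
  shows "walk_cycle k v p \<in> rainbow_copies (cayley_graph m k) xor_coloring (cycle_graph (Suc k))"
proof -
  let ?w = "cube_walk v p"
  have "set_encode (p ` {..<i}) < 2 ^ k" if "i < Suc k" for i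
  proof -
    have "p ` {..<i} \<subseteq> {..<k}"
      using that permutes_image[OF p] by (metis image_mono lessThan_subset_iff less_Suc_eq_le)
    \<comment> \<open>The code is a sum of powers of two, hence monotone in the set.\<close>
    then have "set_encode (p ` {..<i}) \<le> set_encode {..<k}"
      by (simp add: set_encode_def sum_mono2)
    then show ?thesis
      by (simp add: set_encode_lessThan mask_eq_exp_minus_1 le_less_trans)
  qed
  then have w: "?w i < m * 2 ^ k" if "i < Suc k" for i
    using that assms(2) by (simp add: cube_walk_def xor_less_mult_power)
  have color: "(if i < k then 2 ^ p i else mask k) \<in> generators k" for i
    using permutes_in_image[OF p, of i] by (auto simp: generators_def)
  have edge: "edges (walk_cycle k v p) \<subseteq> edges (cayley_graph m k)"
  proof
    fix e assume "e \<in> edges (walk_cycle k v p)"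
    then obtain i where i: "i < Suc k" and e: "e = {?w i, ?w (Suc i mod Suc k)}"
      unfolding walk_cycle_def ugraph.simps by blast
    have "?w i XOR ?w (Suc i mod Suc k) \<in> generators k"
      unfolding walk_cycle_color[OF p i] by (rule color)
    moreover have "?w (Suc i mod Suc k) < m * 2 ^ k"
      by (rule w) (rule mod_less_divisor, simp)
    ultimately show "e \<in> edges (cayley_graph m k)"
      unfolding e cayley_edge_iff using w[OF i] by (intro conjI)
  qed
  have "simple_graph (walk_cycle k v p)"
    unfolding simple_graph_def
  proof (intro conjI ballI)
    fix e assume e: "e \<in> edges (walk_cycle k v p)"
    then obtain i where "i < Suc k" "e = {?w i, ?w (Suc i mod Suc k)}"
      unfolding walk_cycle_def ugraph.simps by blast
    moreover have "?w j \<in> verts (walk_cycle k v p)" if "j < Suc k" for j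
      using that unfolding walk_cycle_def ugraph.simps by (intro imageI) simp
    ultimately show "e \<subseteq> verts (walk_cycle k v p)"
      by (metis empty_subsetI insert_subsetI mod_less_divisor zero_less_Suc)
    have "simple_graph (cayley_graph m k)"
      using assms(1) by (simp add: simple_cayley_graph)
    then show "card e = 2"
      using subsetD[OF edge e] unfolding simple_graph_def by (elim conjE) simp
  qed (simp add: walk_cycle_def)
  moreover have "verts (walk_cycle k v p) \<subseteq> verts (cayley_graph m k)"
    unfolding walk_cycle_def cayley_graph_def ugraph.simps
  proof (rule image_subsetI)
    show "?w i \<in> {..<m * 2 ^ k}" if "i \<in> {0..<Suc k}" for i
      using w[of i] that by simp
  qed
  ultimately have "subgraph (walk_cycle k v p) (cayley_graph m k)"
    using edge by (simp add: subgraph_def)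
  moreover have "rainbow (walk_cycle k v p) xor_coloring"
  proof -
    \<comment> \<open>The color reveals the index of an edge: a power of two gives
      \<open>p i\<close>, and \<open>mask k\<close> marks the closing edge.\<close>
    have "i = j" if ij: "i < Suc k" "j < Suc k"
      and eq: "?w i XOR ?w (Suc i mod Suc k) = ?w j XOR ?w (Suc j mod Suc k)" for i j
    proof -
      have "(if i < k then 2 ^ p i else mask k) = (if j < k then 2 ^ p j else mask k :: nat)"
        using eq unfolding walk_cycle_color[OF p ij(1)] walk_cycle_color[OF p ij(2)] .
      then have "i < k \<and> j < k \<and> p i = p j \<or> i = k \<and> j = k"
        using ij mask_neq_power_two[OF assms(1), of "p i"] mask_neq_power_two[OF assms(1), of "p j"]
        by (auto split: if_splits)
      then show ?thesis
        using injD[OF permutes_inj[OF p]] by blast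
    qed
    then show ?thesis
      unfolding rainbow_def inj_on_def walk_cycle_def ugraph.simps
      by (smt (verit) mem_Collect_eq xor_coloring_doubleton)
  qed
  ultimately show ?thesis
    using isomorphic_walk_cycle[OF permutes_inj[OF p]] by (simp add: rainbow_copies_def)
qed

text \<open>The cycle determines its edge of color \<open>mask k\<close>, whose even endpoint is \<open>v\<close>. The distances
  \<open>set_encode (p ` {..<i})\<close> of the other vertices from \<open>v\<close> then determine \<open>p\<close>.\<close>

lemma walk_cycle_inj:
  assumes k: "k \<ge> 2" and p: "p permutes {..<k}" and q: "q permutes {..<k}"
    and "even u" "even v" and eq: "walk_cycle k u p = walk_cycle k v q"
  shows "u = v \<and> p = q"
proof -
  have "{u, u XOR mask k} \<in> edges (walk_cycle k u p)"
    unfolding walk_cycle_def ugraph.simps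
    by (intro CollectI exI[of _ k]) (simp add: cube_walk_full[OF p] insert_commute)
  then obtain i where i: "i < Suc k"
    and e: "{u, u XOR mask k} = {cube_walk v q i, cube_walk v q (Suc i mod Suc k)}"
    unfolding eq unfolding walk_cycle_def ugraph.simps by blast
  have "u XOR (u XOR mask k) = cube_walk v q i XOR cube_walk v q (Suc i mod Suc k)"
    using arg_cong[OF e, of xor_coloring] by simp
  \<comment> \<open>Only the closing edge has color \<open>mask k\<close>, so the two closing edges
    agree.\<close>
  then have "mask k = (if i < k then 2 ^ q i else mask k :: nat)"
    unfolding walk_cycle_color[OF q i] by (simp flip: xor.assoc)
  then have "i = k"
    using i mask_neq_power_two[OF k] by (auto split: if_splits)
  then have "{u, u XOR mask k} = {v, v XOR mask k}"
    using e by (auto simp: cube_walk_full[OF q])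
  \<comment> \<open>\<open>mask k\<close> has bit 0, so the other endpoint of each closing edge is
    odd and cannot be confused with the start.\<close>
  moreover have "odd (u XOR mask k)" "odd (v XOR mask k)"
    using assms by (auto simp: even_xor_iff even_mask_iff)
  ultimately have uv: "u = v"
    using \<open>even u\<close> \<open>even v\<close> by (auto simp: doubleton_eq_iff)
  have img: "p ` {..<i} = q ` {..<i}" if "i < Suc k" for i
  proof -
    have "cube_walk u p i \<in> verts (walk_cycle k u p)"
      using that unfolding walk_cycle_def ugraph.simps by (intro imageI) simp
    then obtain j where "cube_walk u p i = cube_walk v q j"
      unfolding eq unfolding walk_cycle_def ugraph.simps by blast
    then have "set_encode (p ` {..<i}) = set_encode (q ` {..<j})"
      by (simp add: cube_walk_def uv)
    \<comment> \<open>Comparing sizes forces \<open>j = i\<close>.\<close>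
    then show ?thesis
      using set_encode_image_eq_imp permutes_inj[OF p] permutes_inj[OF q] by blast
  qed
  have "p i = q i" for i
  proof (cases "i < k")
    case True
    have diff: "{r i} = r ` {..<Suc i} - r ` {..<i}" if "inj r" for r :: "nat \<Rightarrow> nat"
      using that by (auto simp: inj_def lessThan_Suc)
    have "{p i} = {q i}"
      using diff[OF permutes_inj[OF p]] diff[OF permutes_inj[OF q]] img[of i] img[of "Suc i"] True
      by simp
    then show ?thesis
      by simp
  next
    case False
    then show ?thesis
      using p q by (simp add: permutes_not_in)
  qed
  with uv show ?thesis
    by auto
qed

section \<open>Counting the rainbow cycles\<close>

lemma finite_rainbow_copies:
  assumes "simple_graph G"
  shows "finite (rainbow_copies G c H)"
proof (rule finite_imageD)
  let ?g = "\<lambda>K. (verts K, edges K)"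
  show "finite (?g ` rainbow_copies G c H)"
    by (rule finite_subset[of _ "Pow (verts G) \<times> Pow (Pow (verts G))"])
      (use assms in \<open>auto simp: rainbow_copies_def subgraph_def simple_graph_def\<close>)
  show "inj_on ?g (rainbow_copies G c H)"
    by (auto intro!: inj_onI ugraph.equality)
qed

lemma card_rainbow_cycles_ge:
  assumes "k \<ge> 2"
  shows "fact k * (m * 2 ^ (k - 1)) \<le>
    card (rainbow_copies (cayley_graph m k) xor_coloring (cycle_graph (Suc k)))"
proof -
  \<comment> \<open>The first factor is the set of even vertices, the admissible starts; the second
    orders the unit vectors.\<close>
  let ?A = "(\<lambda>i. 2 * i) ` {..<m * 2 ^ (k - 1)} \<times> {p. p permutes {..<k}}"
  let ?R = "rainbow_copies (cayley_graph m k) xor_coloring (cycle_graph (Suc k))"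
  have pow: "2 * 2 ^ (k - 1) = (2 :: nat) ^ k"
    using assms by (cases k) auto
  have "2 * i < m * 2 ^ k" if "i < m * 2 ^ (k - 1)" for i
    using that unfolding pow[symmetric] by simp
  then have sub: "(\<lambda>(v, p). walk_cycle k v p) ` ?A \<subseteq> ?R"
    using walk_cycle_in_rainbow_copies[OF assms]
    by (intro image_subsetI) (clarsimp simp only: mem_Times_iff image_iff split_beta mem_Collect_eq lessThan_iff)
  have inj: "inj_on (\<lambda>(v, p). walk_cycle k v p) ?A"
  proof (rule inj_onI, clarify)
    fix i j p q
    assume "p permutes {..<k}" "q permutes {..<k}" "walk_cycle k (2 * i) p = walk_cycle k (2 * j) q"
    then show "2 * i = 2 * j \<and> p = q"
      by (intro walk_cycle_inj[OF assms]) simp_all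
  qed
  have "card ?A = fact k * (m * 2 ^ (k - 1))"
    by (simp add: card_cartesian_product card_image inj_on_def card_permutations)
  moreover have "finite ?R"
    using assms by (simp add: finite_rainbow_copies simple_cayley_graph)
  ultimately show ?thesis
    using card_inj_on_le[OF inj sub] by simp
qed

theorem theorem4:
  fixes l n :: nat
  assumes "l \<ge> 3" and "n > 0" and "2 ^ (l - 1) dvd n"
  shows "fact (l - 1) / 2 * real n \<le> real (ex_star n (cycle_graph l) (path_graph l))"
proof -
  define k where "k = l - 1"
  have k: "k \<ge> 2" and l: "l = Suc k"
    using assms(1) by (auto simp: k_def)
  from assms(3) obtain m where n: "n = m * 2 ^ k"
    by (auto simp: k_def dvd_def mult.commute)
  let ?R = "rainbow_copies (cayley_graph m k) xor_coloring (cycle_graph l)"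
  have "simple_graph (cayley_graph m k) \<and> card (verts (cayley_graph m k)) = n \<and>
      proper_edge_coloring (cayley_graph m k) xor_coloring \<and>
      rainbow_copies (cayley_graph m k) xor_coloring (path_graph l) = {}"
    using simple_cayley_graph[of k m] proper_xor_coloring[of m k] no_rainbow_path[OF k, of m] k
    by (simp add: l n) (simp add: cayley_graph_def)
  then have "card ?R \<in> rainbow_counts n (cycle_graph l) (path_graph l)"
    unfolding rainbow_counts_def by blast
  then have "card ?R \<le> ex_star n (cycle_graph l) (path_graph l)"
    unfolding ex_star_def by (intro Max_ge finite_rainbow_counts)
  then have "fact k * (m * 2 ^ (k - 1)) \<le> ex_star n (cycle_graph l) (path_graph l)"
    using card_rainbow_cycles_ge[OF k, of m] l by simp
  then have "real (fact k * (m * 2 ^ (k - 1))) \<le> real (ex_star n (cycle_graph l) (path_graph l))"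
    by (simp only: of_nat_le_iff)
  \<comment> \<open>The even vertices are half of all \<open>n\<close>, which accounts for the
    denominator 2.\<close>
  moreover have "real n = 2 * real (m * 2 ^ (k - 1))"
    using k unfolding n by (cases k) auto
  ultimately show ?thesis
    by (simp add: k_def)
qed

end
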